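(* Let $P_1,\ldots,P_r$ be polytopes in $\mathbb{R}^d$ and let $P=P_1+\cdots+P_r$ be their Minkowski sum. Then there exist polytopes $P_1',\ldots,P_r'$ in $\mathbb{R}^d$ that are relatively in general position, with Minkowski sum $P'=P_1'+\cdots+P_r'$, such that $f_k(P_i')=f_k(P_i)$ for all $i\in\{1,\ldots,r\}$ and all $k$, and such that $f_k(P')\geq f_k(P)$ for all $k$.
   Context: Polytopes are nonempty convex polytopes. For a polytope $Q$, $f_k(Q)$ denotes the number of $k$-dimensional faces of $Q$ (including $Q$ itself; the empty face has dimension $-1$). Every nonempty face $F$ of a Minkowski sum $P=P_1+\cdots+P_r$ can be written uniquely as $F=F_1+\cdots+F_r$ with $F_i$ a nonempty face of $P_i$; this is called the decomposition of $F$. The decomposition is exact if $\dim(F)=\dim(F_1)+\cdots+\dim(F_r)$. The polytopes $P_1,\ldots,P_r$ are relatively in general position if every facet of $P_1+\cdots+P_r$ has an exact decomposition. *)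

theory Defs
  imports "HOL-Analysis.Analysis"
begin

(* The Minkowski sum of sets A i, i \<in> {1..r}, is sum A {1..r}, with the pointwise addition
   of sets from Set_Algebras (cf. set_sum_alt). *)

(* face_of admits the empty face, and aff_dim {} = -1, so k ranges over the integers. *)
definition num_faces :: "int \<Rightarrow> 'a::euclidean_space set \<Rightarrow> nat" where
  "num_faces k Q = card {F. F face_of Q \<and> aff_dim F = k}"

definition face_decomposition ::
    "nat \<Rightarrow> (nat \<Rightarrow> 'a::euclidean_space set) \<Rightarrow> 'a set \<Rightarrow> (nat \<Rightarrow> 'a set) \<Rightarrow> bool" where
  "face_decomposition r P F G \<longleftrightarrow>
     (\<forall>i\<in>{1..r}. G i face_of P i \<and> G i \<noteq> {}) \<and> F = (\<Sum>i\<in>{1..r}. G i)"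

definition exact_decomposition ::
    "nat \<Rightarrow> (nat \<Rightarrow> 'a::euclidean_space set) \<Rightarrow> 'a set \<Rightarrow> (nat \<Rightarrow> 'a set) \<Rightarrow> bool" where
  "exact_decomposition r P F G \<longleftrightarrow>
     face_decomposition r P F G \<and> aff_dim F = (\<Sum>i\<in>{1..r}. aff_dim (G i))"

(* For nonempty polytopes the decomposition of a nonempty face of the sum exists and is unique
   on {1..r}, so "its decomposition is exact" is the same as "it has an exact decomposition".
   By definition facet_of does not count the empty face as a facet, not even of a point. *)
definition relatively_in_general_position ::
    "nat \<Rightarrow> (nat \<Rightarrow> 'a::euclidean_space set) \<Rightarrow> bool" where
  "relatively_in_general_position r P \<longleftrightarrow>
     (\<forall>F. F facet_of (\<Sum>i\<in>{1..r}. P i) \<longrightarrow> (\<exists>G. exact_decomposition r P F G))"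

end

theory Submission
  imports Defs
begin

text \<open>
  The new polytopes are linear images \<open>A i ` P i\<close> under linear bijections close to the identity
  that are in general position. Such images have the face numbers of the \<open>P i\<close>, so two things
  have to be seen.

  General position. The direction space of a face of the new sum is the sum of the spaces
  \<open>A i ` L i\<close>, where \<open>L i\<close> is the direction space of a face of \<open>P i\<close>. There are finitely
  many families \<open>L\<close> of this kind, and arbitrarily near the identity there are maps such that
  all these sums have the largest conceivable dimension, the minimum of the dimension of the
  space and of the sum of the \<open>dim (L i)\<close> (\<open>linear_maps_in_general_position\<close>). A facet does
  not have full dimension, so its decomposition is exact (\<open>general_position_images\<close>).

  Face numbers of the sum. The new sum is a polytope close to the old one in the Hausdorff
  distance, and the number of \<open>k\<close>-dimensional faces is lower semicontinuous for it
  (\<open>num_faces_lower_semicontinuous\<close>). For this, every nonempty face \<open>F\<close> of a polytope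
  \<open>P\<close> with a point \<open>p\<close> of its relative interior must have a counterpart in each polytope \<open>Q\<close>
  near \<open>P\<close>: a face of the same dimension that lies near \<open>F\<close> and passes near \<open>p\<close>
  (\<open>face_of_close_polytope\<close>). If the functional \<open>u\<close> exposes \<open>F\<close>, and \<open>L\<close> is the direction
  space of \<open>F\<close>, the counterpart is found by maximising \<open>u\<close> over the points of \<open>Q\<close> that
  project orthogonally to \<open>L\<close> as a generic point \<open>q\<close> near \<open>p\<close> does. The Lagrange multiplier
  of this linear program is a small \<open>w \<in> L\<close> (\<open>small_lagrange_multiplier\<close>), so the maximum
  lies in a face exposed by a functional near \<open>u\<close>. A smallest face of that face over \<open>q\<close>
  has dimension at most \<open>dim L\<close> because it has no direction orthogonal to \<open>L\<close>
  (\<open>face_meeting_translate_dim_le\<close>), and at least \<open>dim L\<close> because the points under faces of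
  smaller dimension form a null set (\<open>exists_near_point_avoiding_low_dim\<close>).
\<close>

section \<open>Direction spaces and sums of subspaces\<close>

definition direction :: "'a::euclidean_space set \<Rightarrow> 'a set" where
  "direction S = span {x - y |x y. x \<in> S \<and> y \<in> S}"

lemma subspace_direction: "subspace (direction S)"
  by (simp add: direction_def)

lemma diff_mem_direction: "x \<in> S \<Longrightarrow> y \<in> S \<Longrightarrow> x - y \<in> direction S"
  unfolding direction_def by (rule span_base) blast

lemma direction_eq_span_translate:
  assumes "a \<in> S"
  shows "direction S = span ((\<lambda>x. x - a) ` S)"
proof
  have "x - y \<in> span ((\<lambda>x. x - a) ` S)" if "x \<in> S" "y \<in> S" for x y
  proof -
    have "(x - a) - (y - a) \<in> span ((\<lambda>x. x - a) ` S)"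
      using that by (intro span_diff span_base) auto
    then show ?thesis by simp
  qed
  then show "direction S \<subseteq> span ((\<lambda>x. x - a) ` S)"
    unfolding direction_def by (intro span_minimal) auto
  show "span ((\<lambda>x. x - a) ` S) \<subseteq> direction S"
    using assms by (intro span_minimal) (auto simp: subspace_direction diff_mem_direction)
qed

lemma aff_dim_eq_dim_direction:
  assumes "S \<noteq> {}"
  shows "aff_dim S = int (dim (direction S))"
proof -
  from assms obtain a where a: "a \<in> S" by blast
  then show ?thesis
    using aff_dim_eq_dim_subtract[of a S] by (simp add: direction_eq_span_translate[OF a] hull_inc)
qed

lemma affine_hull_eq_translate_direction:
  assumes "a \<in> S"
  shows "affine hull S = (+) a ` direction S"
  using affine_hull_span_gen[of a S] assms
  by (simp add: direction_eq_span_translate[OF assms] hull_inc)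

lemma direction_linear_image:
  assumes "linear f"
  shows "direction (f ` S) = f ` direction S"
proof -
  have "{x - y |x y. x \<in> f ` S \<and> y \<in> f ` S} = f ` {x - y |x y. x \<in> S \<and> y \<in> S}" (is "?L = ?R")
  proof
    show "?L \<subseteq> ?R"
    proof clarify
      fix u v assume "u \<in> S" "v \<in> S"
      then show "f u - f v \<in> ?R"
        by (intro image_eqI[of _ _ "u - v"]) (auto simp: linear_diff[OF assms])
    qed
    show "?R \<subseteq> ?L"
      using linear_diff[OF assms] by fastforce
  qed
  then show ?thesis
    by (simp add: direction_def linear_span_image[OF assms])
qed

lemma set_plus_eq_sums: "S + T = {x + y |x y. x \<in> S \<and> y \<in> T}"
  by (auto simp: set_plus_def)

lemma subspace_set_plus: "subspace S \<Longrightarrow> subspace T \<Longrightarrow> subspace (S + T)"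
  by (simp add: set_plus_eq_sums subspace_sums)

lemma dim_set_plus_Int:
  fixes S T :: "'a::euclidean_space set"
  shows "subspace S \<Longrightarrow> subspace T \<Longrightarrow> dim (S + T) + dim (S \<inter> T) = dim S + dim T"
  by (simp add: set_plus_eq_sums dim_sums_Int)

lemma direction_set_plus:
  fixes S T :: "'a::euclidean_space set"
  assumes "S \<noteq> {}" "T \<noteq> {}"
  shows "direction (S + T) = direction S + direction T"
proof
  have "(s + t) - (s' + t') \<in> direction S + direction T"
    if "s \<in> S" "s' \<in> S" "t \<in> T" "t' \<in> T" for s s' t t'
  proof -
    have "(s - s') + (t - t') \<in> direction S + direction T"
      using that by (intro set_plus_intro diff_mem_direction)
    then show ?thesis by (simp add: algebra_simps)
  qed
  then show "direction (S + T) \<subseteq> direction S + direction T"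
    unfolding direction_def[of "S + T"]
    by (intro span_minimal subspace_set_plus subspace_direction) (auto elim!: set_plus_elim)
  obtain s0 t0 where s0: "s0 \<in> S" and t0: "t0 \<in> T" using assms by blast
  have "s - s' \<in> direction (S + T)" if "s \<in> S" "s' \<in> S" for s s'
    using diff_mem_direction[of "s + t0" "S + T" "s' + t0"] that t0 by auto
  then have 1: "direction S \<subseteq> direction (S + T)"
    unfolding direction_def[of S] by (intro span_minimal subspace_direction) auto
  have "t - t' \<in> direction (S + T)" if "t \<in> T" "t' \<in> T" for t t'
    using diff_mem_direction[of "s0 + t" "S + T" "s0 + t'"] that s0 by auto
  then have 2: "direction T \<subseteq> direction (S + T)"
    unfolding direction_def[of T] by (intro span_minimal subspace_direction) auto
  show "direction S + direction T \<subseteq> direction (S + T)"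
    using 1 2 by (auto elim!: set_plus_elim intro!: subspace_add[OF subspace_direction])
qed

lemma set_sum_nonempty:
  assumes "finite I" "\<And>i. i \<in> I \<Longrightarrow> S i \<noteq> {}"
  shows "(\<Sum>i\<in>I. S i) \<noteq> ({} :: 'a::comm_monoid_add set)"
  using assms
proof (induction I rule: finite_induct)
  case (insert j I)
  then obtain x y where "x \<in> S j" "y \<in> (\<Sum>i\<in>I. S i)" by blast
  with insert show ?case by auto
qed simp

lemma direction_set_sum:
  fixes S :: "'i \<Rightarrow> 'a::euclidean_space set"
  assumes "finite I" "\<And>i. i \<in> I \<Longrightarrow> S i \<noteq> {}"
  shows "direction (\<Sum>i\<in>I. S i) = (\<Sum>i\<in>I. direction (S i))"
  using assms
proof (induction I rule: finite_induct)
  case empty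
  then show ?case by (simp add: direction_def set_zero)
next
  case (insert j I)
  then show ?case by (simp add: direction_set_plus set_sum_nonempty)
qed

lemma subspace_set_sum:
  assumes "\<And>i. i \<in> I \<Longrightarrow> subspace (W i)"
  shows "subspace (\<Sum>i\<in>I. W i)"
  using assms
  by (induction I rule: infinite_finite_induct) (auto simp: subspace_set_plus set_zero)

lemma set_plus_subset_subspace: "subspace U \<Longrightarrow> S \<subseteq> U \<Longrightarrow> T \<subseteq> U \<Longrightarrow> S + T \<subseteq> U"
  by (auto elim!: set_plus_elim intro!: subspace_add)

lemma subset_set_plus_left: "0 \<in> T \<Longrightarrow> (S::'a::comm_monoid_add set) \<subseteq> S + T"
  by (metis add.commute set_zero_plus2)

lemma dim_set_sum_le:
  fixes W :: "'i \<Rightarrow> 'a::euclidean_space set"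
  assumes "finite I" "\<And>i. i \<in> I \<Longrightarrow> subspace (W i)"
  shows "dim (\<Sum>i\<in>I. W i) \<le> (\<Sum>i\<in>I. dim (W i))"
  using assms
proof (induction I rule: finite_induct)
  case (insert j I)
  then have "dim (W j + (\<Sum>i\<in>I. W i)) \<le> dim (W j) + dim (\<Sum>i\<in>I. W i)"
    using dim_set_plus_Int[of "W j" "\<Sum>i\<in>I. W i"] by (simp add: subspace_set_sum)
  with insert show ?case by fastforce
qed (simp add: set_zero)

text \<open>A sum of subspaces whose dimension falls short of the sum of the dimensions has a
  nontrivial relation, and any summand occurring in it meets the sum of the others.\<close>

lemma deficient_set_sum_overlap:
  fixes W :: "'i \<Rightarrow> 'a::euclidean_space set"
  assumes "finite I" "\<And>i. i \<in> I \<Longrightarrow> subspace (W i)"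
    and "dim (\<Sum>i\<in>I. W i) < (\<Sum>i\<in>I. dim (W i))"
  shows "\<exists>j\<in>I. \<exists>x. x \<noteq> 0 \<and> x \<in> W j \<and> x \<in> (\<Sum>i\<in>I - {j}. W i)"
  using assms
proof (induction I rule: finite_induct)
  case empty
  then show ?case by (simp add: set_zero)
next
  case (insert j I)
  let ?S = "\<Sum>i\<in>I. W i"
  have sub: "subspace (W j)" "subspace ?S"
    using insert by (auto intro: subspace_set_sum)
  show ?case
  proof (cases "W j \<inter> ?S \<subseteq> {0}")
    case False
    then show ?thesis using insert.hyps by (auto simp: insert_Diff_if)
  next
    case True
    then have "dim (W j \<inter> ?S) = 0"
      by (simp add: dim_eq_0)
    then have "dim (W j + ?S) = dim (W j) + dim ?S"
      using dim_set_plus_Int[OF sub] by linarith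
    then have "dim ?S < (\<Sum>i\<in>I. dim (W i))"
      using insert by simp
    then obtain k x where k: "k \<in> I" "x \<noteq> 0" "x \<in> W k" "x \<in> (\<Sum>i\<in>I - {k}. W i)"
      using insert by auto
    have "(\<Sum>i\<in>insert j I - {k}. W i) = W j + (\<Sum>i\<in>I - {k}. W i)"
      using insert.hyps k(1) by (subst insert_Diff_if) auto
    then have "x \<in> (\<Sum>i\<in>insert j I - {k}. W i)"
      using k(4) set_zero_plus2[OF subspace_0[OF sub(1)]] by auto
    then show ?thesis using k by auto
  qed
qed

section \<open>Linear maps in general position\<close>

text \<open>Lifting a basis through \<open>A\<close> gives a linear map \<open>s\<close> such that every \<open>w\<close> in
  \<open>U + A V\<close> is the sum of \<open>w - A (s w) \<in> U\<close> and of \<open>A (s w)\<close> with \<open>s w \<in> V\<close>. Writing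
  \<open>B\<close> for \<open>A\<close> in the second term gives a map into \<open>U + B V\<close>, which is injective as soon as
  it differs from the identity by at most half the norm.\<close>

lemma dim_set_plus_image_semicontinuous:
  fixes A :: "'a::euclidean_space \<Rightarrow> 'a"
  assumes U: "subspace U" and V: "subspace V" and A: "linear A"
  shows "\<exists>e>0. \<forall>B. linear B \<longrightarrow> (\<forall>x. norm (B x - A x) \<le> e * norm x)
    \<longrightarrow> dim (U + A ` V) \<le> dim (U + B ` V)"
proof -
  let ?W = "U + A ` V"
  obtain C where C: "C \<subseteq> ?W" "independent C" "?W \<subseteq> span C"
    by (rule basis_exists) blast
  have "\<exists>v\<in>V. c - A v \<in> U" if "c \<in> C" for c
  proof -
    from that C(1) have "c \<in> ?W" by blast
    then obtain u w where "c = u + w" "u \<in> U" "w \<in> A ` V" by (rule set_plus_elim)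
    then show ?thesis by force
  qed
  then obtain s0 where s0: "\<And>c. c \<in> C \<Longrightarrow> s0 c \<in> V \<and> c - A (s0 c) \<in> U"
    by metis
  obtain s where s: "linear s" "\<And>c. c \<in> C \<Longrightarrow> s c = s0 c"
    using linear_independent_extend[OF C(2), of s0] by blast
  have lift: "s w \<in> V \<and> w - A (s w) \<in> U" if "w \<in> span C" for w
    using that
  proof (induction rule: span_induct)
    case base
    have 1: "subspace {w. s w \<in> V}"
      using linear_subspace_vimage[OF s(1) V] by (simp add: vimage_def)
    have "linear (\<lambda>w. w - A (s w))"
      using linear_compose[OF s(1) A] by (intro linear_compose_sub linear_ident) (simp add: o_def)
    from linear_subspace_vimage[OF this U]
    have 2: "subspace {w. w - A (s w) \<in> U}" by (simp add: vimage_def)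
    show ?case using subspace_inter[OF 1 2] by (simp add: Int_def)
  next
    case (step x)
    then show ?case using s0 s(2) by auto
  qed
  obtain K where K: "K > 0" "\<And>x. norm (s x) \<le> K * norm x"
    using linear_bounded_pos[OF s(1)] by blast
  show ?thesis
  proof (intro exI[of _ "1 / (2 * K)"] conjI allI impI)
    show "0 < 1 / (2 * K)" using K by simp
    fix B :: "'a \<Rightarrow> 'a"
    assume B: "linear B" and close: "\<forall>x. norm (B x - A x) \<le> 1 / (2 * K) * norm x"
    define T where "T w = w + (B (s w) - A (s w))" for w
    have linT: "linear T"
      unfolding T_def
      using linear_compose[OF s(1) A] linear_compose[OF s(1) B]
      by (intro linear_compose_add linear_compose_sub linear_ident) (simp_all add: o_def)
    have "norm (T w - w) \<le> 1/2 * norm w" for w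
    proof -
      have "norm (T w - w) \<le> 1 / (2 * K) * norm (s w)"
        using close by (simp add: T_def)
      also have "\<dots> \<le> 1 / (2 * K) * (K * norm w)"
        using K by (intro mult_left_mono) auto
      also have "\<dots> = 1/2 * norm w" using K by simp
      finally show ?thesis .
    qed
    then have inj: "inj T"
      using linear_injective_contraction[OF linT, of "1/2"] by simp
    have "T w \<in> U + B ` V" if "w \<in> ?W" for w
    proof -
      have "(w - A (s w)) + B (s w) \<in> U + B ` V"
        using lift[of w] that C(3) by blast
      then show ?thesis by (simp add: T_def algebra_simps)
    qed
    then have "dim (T ` ?W) \<le> dim (U + B ` V)"
      by (intro dim_subset) auto
    then show "dim ?W \<le> dim (U + B ` V)"
      using dim_image_eq[OF linT inj_on_subset[OF inj subset_UNIV], of ?W] by simp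
  qed
qed

lemma finite_common_radius:
  fixes Q :: "'b \<Rightarrow> real \<Rightarrow> bool"
  assumes "finite S" "\<And>s. s \<in> S \<Longrightarrow> \<exists>e>0. Q s e"
    and "\<And>s e e'. s \<in> S \<Longrightarrow> Q s e \<Longrightarrow> 0 < e' \<Longrightarrow> e' \<le> e \<Longrightarrow> Q s e'"
  shows "\<exists>e>0. \<forall>s\<in>S. Q s e"
  using assms
proof (induction S rule: finite_induct)
  case empty
  then show ?case using zero_less_one by blast
next
  case (insert t S)
  have "\<exists>e>0. \<forall>s\<in>S. Q s e"
    by (rule insert.IH) (rule insert.prems(1) insert.prems(2), auto)+
  moreover have "\<exists>e>0. Q t e"
    by (rule insert.prems(1)) simp
  ultimately obtain e1 e2 where e: "e1 > 0" "\<forall>s\<in>S. Q s e1" "e2 > 0" "Q t e2"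
    by blast
  have "Q s (min e1 e2)" if "s \<in> insert t S" for s
  proof (cases "s = t")
    case True
    then show ?thesis using insert.prems(2)[OF that, of e2] e by simp
  next
    case False
    then show ?thesis using insert.prems(2)[OF that, of e1] e that by simp
  qed
  then show ?case using e by (intro exI[of _ "min e1 e2"]) simp
qed

text \<open>Choose the maps close to the identity so that the dimensions of all the sums together are
  as large as possible. If one sum were deficient, some \<open>A j v\<close> would lie in the sum of
  the other images; adding to \<open>A j\<close> a small rank-one map
  that does not kill \<open>v\<close> and whose range is a line outside the sum enlarges this sum, and
  by semicontinuity makes the dimension of no other smaller.\<close>

lemma linear_maps_in_general_position:
  fixes \<L> :: "('i \<Rightarrow> 'a::euclidean_space set) set"
  assumes I: "finite I" and fin: "finite \<L>"
    and sub: "\<And>L i. L \<in> \<L> \<Longrightarrow> i \<in> I \<Longrightarrow> subspace (L i)"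
    and eps: "0 < \<epsilon>" "\<epsilon> \<le> 1"
  obtains A where "\<And>i. i \<in> I \<Longrightarrow> linear (A i)" "\<And>i. i \<in> I \<Longrightarrow> inj (A i)"
    "\<And>i x. i \<in> I \<Longrightarrow> norm (A i x - x) \<le> \<epsilon> * norm x"
    "\<And>L. L \<in> \<L> \<Longrightarrow> min DIM('a) (\<Sum>i\<in>I. dim (L i)) \<le> dim (\<Sum>i\<in>I. A i ` L i)"
proof -
  define near where "near A \<longleftrightarrow>
    (\<forall>i\<in>I. linear (A i) \<and> (\<exists>\<delta><\<epsilon>. \<forall>x. norm (A i x - x) \<le> \<delta> * norm x))"
    for A :: "'i \<Rightarrow> 'a \<Rightarrow> 'a"
  define \<phi> where "\<phi> A = (\<Sum>L\<in>\<L>. dim (\<Sum>i\<in>I. A i ` L i))" for A :: "'i \<Rightarrow> 'a \<Rightarrow> 'a"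
  have near_id: "near (\<lambda>i x. x)"
    using eps by (auto simp: near_def linear_ident intro!: exI[of _ 0])
  have "\<phi> A < card \<L> * DIM('a) + 1" for A
    unfolding \<phi>_def
    using sum_bounded_above[of \<L> "\<lambda>L. dim (\<Sum>i\<in>I. A i ` L i)" "DIM('a)"]
    by (simp add: dim_subset_UNIV less_Suc_eq_le)
  then obtain A where A: "near A" and max: "\<And>B. near B \<Longrightarrow> \<phi> B \<le> \<phi> A"
    using ex_has_greatest_nat[of near, OF near_id, of \<phi> "card \<L> * DIM('a) + 1"] by blast
  have lin: "linear (A i)" if "i \<in> I" for i
    using A that by (simp add: near_def)
  have inj: "inj (A i)" if i: "i \<in> I" for i
  proof -
    obtain \<delta> where "\<delta> < \<epsilon>" "\<And>x. norm (A i x - x) \<le> \<delta> * norm x"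
      using A i by (auto simp: near_def)
    then show ?thesis
      using linear_injective_contraction[OF lin[OF i], of \<delta>] eps by auto
  qed
  have close: "norm (A i x - x) \<le> \<epsilon> * norm x" if i: "i \<in> I" for i x
  proof -
    obtain \<delta> where "\<delta> < \<epsilon>" "norm (A i x - x) \<le> \<delta> * norm x"
      using A i by (auto simp: near_def)
    then show ?thesis
      using mult_right_mono[of \<delta> \<epsilon> "norm x"] by simp
  qed
  have subim: "subspace (A i ` L i)" if "L \<in> \<L>" "i \<in> I" for L i
    using that by (intro linear_subspace_image lin sub)
  have "min DIM('a) (\<Sum>i\<in>I. dim (L i)) \<le> dim (\<Sum>i\<in>I. A i ` L i)" if L: "L \<in> \<L>" for L
  proof (rule ccontr)
    let ?W = "\<Sum>i\<in>I. A i ` L i"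
    assume "\<not> ?thesis"
    then have small: "dim ?W < DIM('a)" "dim ?W < (\<Sum>i\<in>I. dim (L i))" by auto
    have subW: "subspace ?W"
      using subim[OF L] by (rule subspace_set_sum)
    obtain z where z: "z \<notin> ?W"
      using small(1) by (metis UNIV_eq_I dim_UNIV less_irrefl)
    then have z0: "z \<noteq> 0"
      using subspace_0[OF subW] by blast
    have "dim (A i ` L i) = dim (L i)" if "i \<in> I" for i
      using that inj by (intro dim_image_eq lin) (auto intro: inj_on_subset)
    then have "dim ?W < (\<Sum>i\<in>I. dim (A i ` L i))"
      using small(2) by simp
    then obtain j x where j: "j \<in> I" and x: "x \<noteq> 0" "x \<in> A j ` L j" "x \<in> (\<Sum>i\<in>I - {j}. A i ` L i)"
      using deficient_set_sum_overlap[OF I, of "\<lambda>i. A i ` L i"] subim[OF L] by blast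
    obtain v where v: "v \<in> L j" "x = A j v" using x by blast
    have v0: "v \<noteq> 0"
      using x(1) v(2) linear_0[OF lin[OF j]] by auto
    let ?U = "\<lambda>L'. \<Sum>i\<in>I - {j}. A i ` L' i"
    have split: "(\<Sum>i\<in>I. (A(j := B)) i ` L' i) = ?U L' + B ` L' j" for B L'
    proof -
      have "(\<Sum>i\<in>I - {j}. (A(j := B)) i ` L' i) = ?U L'"
        by (rule sum.cong) auto
      then show ?thesis
        using sum.remove[OF I j, of "\<lambda>i. (A(j := B)) i ` L' i"] by (simp add: add.commute)
    qed
    have split0: "(\<Sum>i\<in>I. A i ` L' i) = ?U L' + A j ` L' j" for L'
      using split[of "A j" L'] by simp
    have subU: "subspace (?U L')" if "L' \<in> \<L>" for L'
      using subim[OF that] by (auto intro: subspace_set_sum)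
    have "\<exists>e>0. \<forall>L'\<in>\<L>. \<forall>B. linear B \<longrightarrow> (\<forall>x. norm (B x - A j x) \<le> e * norm x)
        \<longrightarrow> dim (?U L' + A j ` L' j) \<le> dim (?U L' + B ` L' j)"
    proof (rule finite_common_radius[OF fin])
      fix L' e e' assume *: "\<forall>B. linear B \<longrightarrow> (\<forall>x. norm (B x - A j x) \<le> e * norm x)
          \<longrightarrow> dim (?U L' + A j ` L' j) \<le> dim (?U L' + B ` L' j)"
        and e': "0 < e'" "e' \<le> (e::real)"
      have "e' * norm x \<le> e * norm x" for x :: 'a
        using e' by (intro mult_right_mono) auto
      with * show "\<forall>B. linear B \<longrightarrow> (\<forall>x. norm (B x - A j x) \<le> e' * norm x)
          \<longrightarrow> dim (?U L' + A j ` L' j) \<le> dim (?U L' + B ` L' j)"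
        by (meson order_trans)
    qed (rule dim_set_plus_image_semicontinuous, auto intro: subU sub j lin)
    then obtain e where e: "e > 0" and semi: "\<And>L' B. L' \<in> \<L> \<Longrightarrow> linear B \<Longrightarrow>
        (\<And>x. norm (B x - A j x) \<le> e * norm x) \<Longrightarrow> dim (?U L' + A j ` L' j) \<le> dim (?U L' + B ` L' j)"
      by blast
    obtain \<delta> where \<delta>: "\<delta> < \<epsilon>" "\<And>x. norm (A j x - x) \<le> \<delta> * norm x"
      using A j by (auto simp: near_def)
    \<comment> \<open>The size of the rank-one perturbation: it keeps the maps within \<open>\<epsilon>\<close> of the identity
      and every other sum within the range of semicontinuity.\<close>
    define \<tau> where "\<tau> = min e ((\<epsilon> - \<delta>) / 2)"
    have \<tau>: "0 < \<tau>" "\<tau> \<le> e" "\<delta> + \<tau> < \<epsilon>"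
      using e \<delta>(1) by (auto simp: \<tau>_def min_def field_simps)
    define t where "t = \<tau> / (norm v * norm z)"
    have t: "0 < t" "t * (norm v * norm z) = \<tau>"
      using \<tau>(1) v0 z0 by (auto simp: t_def)
    define B where "B x = A j x + (t * (v \<bullet> x)) *\<^sub>R z" for x
    have linB: "linear B"
      unfolding B_def
      by (intro linearI)
        (auto simp: linear_add[OF lin[OF j]] linear_scale[OF lin[OF j]] inner_add_right algebra_simps)
    have B_close: "norm (B x - A j x) \<le> \<tau> * norm x" for x
    proof -
      have "norm (B x - A j x) = t * norm z * \<bar>v \<bullet> x\<bar>"
        using t(1) by (simp add: B_def abs_mult)
      also have "\<dots> \<le> t * norm z * (norm v * norm x)"
        using t(1) by (intro mult_left_mono Cauchy_Schwarz_ineq2) auto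
      also have "\<dots> = \<tau> * norm x"
        by (simp add: t(2)[symmetric])
      finally show ?thesis .
    qed
    have "norm (B x - x) \<le> (\<delta> + \<tau>) * norm x" for x
      using norm_triangle_ineq[of "B x - A j x" "A j x - x"] B_close[of x] \<delta>(2)[of x]
      by (simp add: algebra_simps)
    then have "near (A(j := B))"
      using A linB \<tau>(3) by (auto simp: near_def)
    from max[OF this] have le: "\<phi> (A(j := B)) \<le> \<phi> A" .
    have mono: "dim (\<Sum>i\<in>I. A i ` L' i) \<le> dim (\<Sum>i\<in>I. (A(j := B)) i ` L' i)" if "L' \<in> \<L>" for L'
    proof -
      have "norm (B x - A j x) \<le> e * norm x" for x
        using B_close[of x] mult_right_mono[OF \<tau>(2), of "norm x"] by simp
      then show ?thesis
        using semi[OF that linB] by (simp only: split split0)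
    qed
    \<comment> \<open>Since \<open>A j v\<close> is also in the sum of the other images, the difference \<open>B v - A j v\<close>,
      a nonzero multiple of \<open>z\<close>, is in the new sum; with \<open>z\<close> it contains the old one.\<close>
    let ?W' = "?U L + B ` L j"
    have subW': "subspace ?W'"
      using L j by (intro subspace_set_plus subU linear_subspace_image[OF linB] sub)
    have U: "?U L \<subseteq> ?W'"
      using subspace_0[OF sub[OF L j]] linear_0[OF linB] by (intro subset_set_plus_left) force
    have B_mem: "B l \<in> ?W'" if "l \<in> L j" for l
      using that set_zero_plus2[OF subspace_0[OF subU[OF L]], of "B ` L j"] by blast
    have "B v - A j v \<in> ?W'"
      using U x(3) v by (intro subspace_diff[OF subW'] B_mem) auto
    then have scaled: "inverse (t * (v \<bullet> v)) *\<^sub>R (B v - A j v) \<in> ?W'"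
      by (rule subspace_scale[OF subW'])
    have "inverse (t * (v \<bullet> v)) * (t * (v \<bullet> v)) = 1"
      using t(1) v0 by (intro left_inverse) simp
    moreover have "B v - A j v = (t * (v \<bullet> v)) *\<^sub>R z"
      by (simp add: B_def)
    ultimately have "inverse (t * (v \<bullet> v)) *\<^sub>R (B v - A j v) = z"
      by (simp only: scaleR_scaleR scaleR_one)
    with scaled have z': "z \<in> ?W'"
      by (simp only:)
    have "A j l \<in> ?W'" if "l \<in> L j" for l
    proof -
      have "B l - (t * (v \<bullet> l)) *\<^sub>R z \<in> ?W'"
        using that z' by (intro subspace_diff[OF subW'] subspace_scale[OF subW'] B_mem)
      then show ?thesis by (simp add: B_def)
    qed
    then have "?W \<subseteq> ?W'"
      using U by (subst split0) (intro set_plus_subset_subspace subW', auto)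
    then have "dim (insert z ?W) \<le> dim ?W'"
      using z' by (intro dim_subset) auto
    moreover have "z \<notin> span ?W"
      using z subW by (metis span_eq_iff)
    then have "dim (insert z ?W) = dim ?W + 1"
      using dim_insert[of z ?W] by (simp only: if_False)
    ultimately have "dim ?W < dim (\<Sum>i\<in>I. (A(j := B)) i ` L i)"
      by (simp only: split)
    then have "\<phi> A < \<phi> (A(j := B))"
      unfolding \<phi>_def using mono L by (intro sum_strict_mono_ex1 fin) auto
    with le show False by simp
  qed
  with lin inj close show ?thesis by (rule that)
qed

section \<open>Duality on the fibres of a projection\<close>

lemma continuous_on_Max:
  fixes f :: "'b \<Rightarrow> 'a::topological_space \<Rightarrow> real"
  assumes "finite V" "V \<noteq> {}"
    and "\<And>y. y \<in> V \<Longrightarrow> continuous_on S (f y)"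
  shows "continuous_on S (\<lambda>w. Max ((\<lambda>y. f y w) ` V))"
  using assms
proof (induction V rule: finite_ne_induct)
  case (insert y V)
  then have "continuous_on S (\<lambda>w. max (f y w) (Max ((\<lambda>y. f y w) ` V)))"
    by (intro continuous_on_max) auto
  with insert show ?case by simp
qed simp

lemma inner_le_on_convex_hull:
  fixes V :: "'a::real_inner set"
  assumes "\<And>y. y \<in> V \<Longrightarrow> a \<bullet> y \<le> b" "x \<in> convex hull V"
  shows "a \<bullet> x \<le> b"
  using hull_minimal[of V "{x. a \<bullet> x \<le> b}" convex] assms convex_halfspace_le by blast

text \<open>This is linear programming duality for maximising \<open>u\<close> over the points of \<open>Q\<close> whose
  projection to \<open>L\<close> is that of \<open>q\<close>: the multiplier \<open>w\<close> minimises the convex function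
  \<open>w \<mapsto> max {(u + w) \<bullet> x - w \<bullet> q | x \<in> Q}\<close>. The hypothesis makes its values on the
  sphere of radius \<open>\<delta>\<close> larger than at 0, so that the minimum over the ball lies inside. If
  the points of \<open>Q\<close> where the maximum is attained missed the translate of the orthogonal
  complement of \<open>L\<close> through \<open>q\<close>, a separating direction in \<open>L\<close> would decrease the function.\<close>

lemma small_lagrange_multiplier:
  fixes Q :: "'a::euclidean_space set"
  assumes Q: "polytope Q" "Q \<noteq> {}" and L: "subspace L" and \<delta>: "\<delta> > 0"
    and sphere: "\<And>w. w \<in> L \<Longrightarrow> norm w = \<delta> \<Longrightarrow> \<exists>x\<in>Q. \<forall>y\<in>Q. u \<bullet> y < u \<bullet> x + w \<bullet> (x - q)"
  obtains w x where "w \<in> L" "norm w \<le> \<delta>" "x \<in> Q" "x - q \<in> L\<^sup>\<bottom>" "\<And>y. y \<in> Q \<Longrightarrow> (u + w) \<bullet> y \<le> (u + w) \<bullet> x"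
proof -
  obtain V where V: "finite V" "Q = convex hull V" using Q(1) by (auto simp: polytope_def)
  have V0: "V \<noteq> {}" using Q(2) V(2) by auto
  define f where "f y w = (u + w) \<bullet> y - w \<bullet> q" for y w :: 'a
  define g where "g w = Max ((\<lambda>y. f y w) ` V)" for w
  have f_le: "f y w \<le> g w" if "y \<in> V" for y w
    using V(1) that by (simp add: g_def)
  have f_le_Q: "f y w \<le> g w" if "y \<in> Q" for y w
  proof -
    have "(u + w) \<bullet> y \<le> g w + w \<bullet> q"
    proof (rule inner_le_on_convex_hull)
      show "y \<in> convex hull V" using that V by simp
      show "(u + w) \<bullet> y \<le> g w + w \<bullet> q" if "y \<in> V" for y
        using f_le[OF that, of w] by (simp add: f_def)
    qed
    then show ?thesis by (simp add: f_def)
  qed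
  have g_attained: "\<exists>y\<in>V. f y w = g w" for w
  proof -
    have "g w \<in> (\<lambda>y. f y w) ` V"
      unfolding g_def using V(1) V0 by (intro Max_in) auto
    then show ?thesis by force
  qed
  have cont: "continuous_on S g" for S
    unfolding g_def f_def
    by (intro continuous_on_Max V V0 continuous_intros)
  have "compact (L \<inter> cball 0 \<delta>)"
    by (simp add: L closed_Int_compact closed_subspace)
  moreover have "L \<inter> cball 0 \<delta> \<noteq> {}"
    using subspace_0[OF L] \<delta> by auto
  ultimately obtain w where w: "w \<in> L" "norm w \<le> \<delta>" and w_min: "\<And>w'. w' \<in> L \<Longrightarrow> norm w' \<le> \<delta> \<Longrightarrow> g w \<le> g w'"
    using continuous_attains_inf[of "L \<inter> cball 0 \<delta>" g] cont
    by (metis IntD1 IntD2 IntI mem_cball_0)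
  have "norm w \<noteq> \<delta>"
  proof
    assume "norm w = \<delta>"
    from sphere[OF w(1) this] obtain x where x: "x \<in> Q" "\<And>y. y \<in> Q \<Longrightarrow> u \<bullet> y < u \<bullet> x + w \<bullet> (x - q)"
      by blast
    obtain y where y: "y \<in> V" "f y 0 = g 0" using g_attained by blast
    have "g 0 = u \<bullet> y" using y by (simp add: f_def)
    also have "\<dots> < f x w"
      using x(2)[of y] y(1) V(2) by (simp add: hull_inc f_def algebra_simps)
    also have "\<dots> \<le> g w" by (rule f_le_Q[OF x(1)])
    also have "\<dots> \<le> g 0" using w_min[of 0] subspace_0[OF L] \<delta> by simp
    finally show False by simp
  qed
  then have w_less: "norm w < \<delta>" using w(2) by simp
  define T where "T = convex hull {y \<in> V. f y w = g w}"
  have T: "f x w = g w" "x \<in> Q" if "x \<in> T" for x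
  proof -
    show "x \<in> Q"
      using that hull_mono[of "{y \<in> V. f y w = g w}" V convex] by (auto simp: T_def V(2))
    have "(- (u + w)) \<bullet> x \<le> - (g w + w \<bullet> q)"
      using that unfolding T_def by (rule inner_le_on_convex_hull[rotated])
        (auto simp: f_def simp del: minus_add_distrib)
    with f_le_Q[OF \<open>x \<in> Q\<close>, of w] show "f x w = g w"
      by (simp add: f_def del: minus_add_distrib)
  qed
  have "\<exists>x\<in>T. x - q \<in> L\<^sup>\<bottom>"
  proof (rule ccontr)
    assume none: "\<not> ?thesis"
    let ?C = "T + L\<^sup>\<bottom>"
    have "compact T"
      using V(1) by (simp add: T_def finite_imp_compact_convex_hull)
    moreover have "?C = (\<Union>x\<in>T. \<Union>y\<in>L\<^sup>\<bottom>. {x + y})"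
      by (auto simp: set_plus_def)
    ultimately have "closed ?C"
      using compact_closed_sums[of T "L\<^sup>\<bottom>"] closed_subspace[OF subspace_orthogonal_comp, of L]
      by (simp only:)
    moreover have "convex ?C"
      by (intro convex_set_plus subspace_imp_convex[OF subspace_orthogonal_comp]) (simp add: T_def)
    moreover have "q \<notin> ?C"
    proof
      assume "q \<in> ?C"
      then obtain x m where "q = x + m" "x \<in> T" "m \<in> L\<^sup>\<bottom>" by (rule set_plus_elim)
      then have "x - q = - m" by simp
      then show False
        using none \<open>x \<in> T\<close> subspace_neg[OF subspace_orthogonal_comp \<open>m \<in> L\<^sup>\<bottom>\<close>] by metis
    qed
    ultimately obtain v b where v: "v \<bullet> q < b" "\<And>x. x \<in> ?C \<Longrightarrow> b < v \<bullet> x"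
      using separating_hyperplane_closed_point[of ?C q] by blast
    obtain x0 where "x0 \<in> V" "f x0 w = g w" using g_attained by blast
    then have x0: "x0 \<in> T" by (simp add: T_def hull_inc)
    have "v \<bullet> m = 0" if m: "m \<in> L\<^sup>\<bottom>" for m
    proof (rule ccontr)
      assume nz: "v \<bullet> m \<noteq> 0"
      define t where "t = (b - v \<bullet> x0) / (v \<bullet> m)"
      have "x0 + t *\<^sub>R m \<in> ?C"
        using x0 m by (intro set_plus_intro subspace_scale[OF subspace_orthogonal_comp])
      from v(2)[OF this] show False using nz by (simp add: t_def inner_add_right)
    qed
    then have "v \<in> L\<^sup>\<bottom>\<^sup>\<bottom>"
      by (simp add: orthogonal_comp_def[of "L\<^sup>\<bottom>"] orthogonal_def inner_commute)
    then have vL: "v \<in> L" by (simp add: orthogonal_comp_self[OF L])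
    have v_T: "v \<bullet> (y - q) > 0" if "y \<in> T" for y
    proof -
      have "y + 0 \<in> ?C"
        using that subspace_0[OF subspace_orthogonal_comp] by (intro set_plus_intro)
      then show ?thesis using v(1) v(2)[of y] by (simp add: inner_diff_right)
    qed
    have f_move: "f y (w - t *\<^sub>R v) = f y w - t * (v \<bullet> (y - q))" for y t
      by (simp add: f_def algebra_simps)
    have "\<forall>\<^sub>F t in at_right 0. \<forall>y\<in>V. f y (w - t *\<^sub>R v) < g w"
    proof (intro eventually_ball_finite V(1) ballI)
      fix y assume y: "y \<in> V"
      show "\<forall>\<^sub>F t in at_right 0. f y (w - t *\<^sub>R v) < g w"
      proof (cases "f y w = g w")
        case True
        then have "v \<bullet> (y - q) > 0"
          using y by (intro v_T) (simp add: T_def hull_inc)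
        then show ?thesis
          unfolding f_move True by (intro eventually_mono[OF eventually_at_right_less[of 0]]) simp
      next
        case False
        then have "f y w < g w" using f_le[OF y, of w] by simp
        moreover have "((\<lambda>t. f y (w - t *\<^sub>R v)) \<longlongrightarrow> f y w - 0 * (v \<bullet> (y - q))) (at_right 0)"
          unfolding f_move by (intro tendsto_intros)
        ultimately show ?thesis
          by (auto dest!: order_tendstoD(2))
      qed
    qed
    moreover have "\<forall>\<^sub>F t in at_right 0. norm (w - t *\<^sub>R v) < \<delta>"
    proof -
      have "((\<lambda>t. norm (w - t *\<^sub>R v)) \<longlongrightarrow> norm (w - 0 *\<^sub>R v)) (at_right 0)"
        by (intro tendsto_intros)
      then show ?thesis using w_less by (auto dest!: order_tendstoD(2))
    qed
    ultimately have "\<forall>\<^sub>F t in at_right 0. (\<forall>y\<in>V. f y (w - t *\<^sub>R v) < g w) \<and> norm (w - t *\<^sub>R v) < \<delta>"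
      by (rule eventually_conj)
    then obtain t where t: "\<forall>y\<in>V. f y (w - t *\<^sub>R v) < g w" "norm (w - t *\<^sub>R v) < \<delta>"
      using eventually_happens'[OF trivial_limit_at_right_real] by blast
    obtain y where "y \<in> V" "f y (w - t *\<^sub>R v) = g (w - t *\<^sub>R v)" using g_attained by blast
    then have "g (w - t *\<^sub>R v) < g w" using t(1) by force
    moreover have "g w \<le> g (w - t *\<^sub>R v)"
      using t(2) by (intro w_min subspace_diff[OF L w(1)] subspace_scale[OF L vL]) simp
    ultimately show False by simp
  qed
  then obtain x where x: "x \<in> T" "x - q \<in> L\<^sup>\<bottom>" by blast
  have "(u + w) \<bullet> y \<le> (u + w) \<bullet> x" if "y \<in> Q" for y
    using f_le_Q[OF that, of w] T(1)[OF x(1)] by (simp add: f_def)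
  then show ?thesis using that w x T by blast
qed

section \<open>Faces meeting a generic translate\<close>

text \<open>A face of smallest dimension among those meeting the translate of \<open>L\<^sup>\<bottom>\<close> has no
  direction in common with \<open>L\<^sup>\<bottom>\<close>: moving along such a direction would lead to the
  relative boundary, hence to a smaller face. So its dimension is at most that of \<open>L\<close>.\<close>

lemma face_meeting_translate_dim_le:
  fixes Q :: "'a::euclidean_space set"
  assumes "polytope Q" "subspace L" "x \<in> Q" "x - q \<in> L\<^sup>\<bottom>"
  obtains H y where "H face_of Q" "y \<in> H" "y - q \<in> L\<^sup>\<bottom>" "aff_dim H \<le> int (dim L)"
proof -
  have "\<exists>H y. H face_of Q \<and> y \<in> H \<and> y - q \<in> L\<^sup>\<bottom> \<and> aff_dim H \<le> int (dim L)"
    using assms(1,3,4)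
  proof (induction "dim (direction Q)" arbitrary: Q x rule: less_induct)
    case less
    have Q0: "Q \<noteq> {}" using less.prems(2) by blast
    show ?case
    proof (cases "aff_dim Q \<le> int (dim L)")
      case True
      then show ?thesis
        using face_of_refl[OF polytope_imp_convex[OF less.prems(1)]] less.prems by blast
    next
      case False
      then have gt: "dim (direction Q) > dim L"
        by (simp add: aff_dim_eq_dim_direction[OF Q0])
      have "dim (L\<^sup>\<bottom>) + dim L = DIM('a)"
        using dim_subspace_orthogonal_to_vectors[OF assms(2) subspace_UNIV] by (simp add: orthogonal_comp_def)
      moreover have "dim (direction Q + L\<^sup>\<bottom>) \<le> DIM('a)" by (rule dim_subset_UNIV)
      ultimately have "dim (direction Q \<inter> L\<^sup>\<bottom>) > 0"
        using dim_set_plus_Int[OF subspace_direction[of Q] subspace_orthogonal_comp[of L]] gt by linarith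
      then obtain m where m: "m \<noteq> 0" "m \<in> direction Q" "m \<in> L\<^sup>\<bottom>"
        by (metis Int_iff dim_eq_0 insertI1 less_irrefl singleton_iff subsetI)
      have "\<exists>y\<in>rel_frontier Q. y - q \<in> L\<^sup>\<bottom>"
      proof (cases "x \<in> rel_interior Q")
        case False
        then have "x \<in> rel_frontier Q"
          using less.prems by (simp add: rel_frontier_def polytope_imp_closed)
        then show ?thesis using less.prems by blast
      next
        case True
        have "x + m \<in> affine hull Q"
          using m(2) by (simp add: affine_hull_eq_translate_direction[OF less.prems(2)])
        then obtain d where d: "0 < d" "x + d *\<^sub>R m \<in> rel_frontier Q"
          using ray_to_rel_frontier[OF polytope_imp_bounded[OF less.prems(1)] True _ m(1)] by blast
        have "(x - q) + d *\<^sub>R m \<in> L\<^sup>\<bottom>"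
          using less.prems m by (intro subspace_add subspace_scale subspace_orthogonal_comp)
        then show ?thesis using d by (intro bexI[of _ "x + d *\<^sub>R m"]) (simp_all add: algebra_simps)
      qed
      then obtain y F where y: "F facet_of Q" "y \<in> F" "y - q \<in> L\<^sup>\<bottom>"
        using rel_frontier_of_polyhedron[OF polytope_imp_polyhedron[OF less.prems(1)]] by blast
      have F: "F face_of Q" "F \<noteq> {}" "aff_dim F = aff_dim Q - 1"
        using y(1) by (auto simp: facet_of_def)
      then have "dim (direction F) < dim (direction Q)"
        using aff_dim_eq_dim_direction[OF F(2)] aff_dim_eq_dim_direction[OF Q0] by simp
      from less.hyps[OF this face_of_polytope_polytope[OF less.prems(1) F(1)] y(2,3)]
      show ?thesis using face_of_trans F(1) by blast
    qed
  qed
  then show ?thesis using that by blast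
qed

text \<open>The translates of \<open>L\<^sup>\<bottom>\<close> that meet a given set of dimension less than that of \<open>L\<close> fill
  up a set of dimension less than that of the whole space.\<close>

lemma exists_near_point_avoiding_low_dim:
  fixes \<H> :: "'a::euclidean_space set set"
  assumes "finite \<H>" "subspace L" "\<And>H. H \<in> \<H> \<Longrightarrow> aff_dim H < int (dim L)" "0 < \<eta>"
  obtains q where "dist p q < \<eta>" "\<And>H x. H \<in> \<H> \<Longrightarrow> x \<in> H \<Longrightarrow> x - q \<notin> L\<^sup>\<bottom>"
proof -
  have neg: "negligible (H + L\<^sup>\<bottom>)" if H: "H \<in> \<H>" for H
  proof (cases "H = {}")
    case True
    then show ?thesis by simp
  next
    case False
    then obtain a where a: "a \<in> H" by blast
    let ?S = "direction H + L\<^sup>\<bottom>"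
    have "dim (L\<^sup>\<bottom>) + dim L = DIM('a)"
      using dim_subspace_orthogonal_to_vectors[OF assms(2) subspace_UNIV] by (simp add: orthogonal_comp_def)
    moreover have "dim (direction H) < dim L"
      using assms(3)[OF H] aff_dim_eq_dim_direction[OF False] by simp
    moreover have "dim ?S \<le> dim (direction H) + dim (L\<^sup>\<bottom>)"
      using dim_set_plus_Int[OF subspace_direction[of H] subspace_orthogonal_comp[of L]] by linarith
    ultimately have "negligible ?S"
      by (intro negligible_lowdim) linarith
    then have "negligible ((+) a ` ?S)" by (rule negligible_translation)
    moreover have "H + L\<^sup>\<bottom> \<subseteq> (+) a ` ?S"
    proof
      fix z assume "z \<in> H + L\<^sup>\<bottom>"
      then obtain h m where z: "z = h + m" "h \<in> H" "m \<in> L\<^sup>\<bottom>" by (rule set_plus_elim)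
      then have "(h - a) + m \<in> ?S" using a by (intro set_plus_intro diff_mem_direction)
      then show "z \<in> (+) a ` ?S" using z(1) by (intro image_eqI[of _ _ "(h - a) + m"]) simp_all
    qed
    ultimately show ?thesis by (rule negligible_subset)
  qed
  then have "negligible (\<Union>H\<in>\<H>. H + L\<^sup>\<bottom>)"
    using assms(1) by (intro negligible_Union) auto
  moreover have "\<not> negligible (ball p \<eta>)"
    using assms(4) by (intro open_not_negligible) auto
  ultimately obtain q where q: "q \<in> ball p \<eta>" "q \<notin> (\<Union>H\<in>\<H>. H + L\<^sup>\<bottom>)"
    using negligible_subset by blast
  have "x - q \<notin> L\<^sup>\<bottom>" if "H \<in> \<H>" "x \<in> H" for H x
  proof
    assume "x - q \<in> L\<^sup>\<bottom>"
    then have "x + - (x - q) \<in> H + L\<^sup>\<bottom>"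
      using that by (intro set_plus_intro subspace_neg subspace_orthogonal_comp)
    then show False using q(2) that(1) by auto
  qed
  with q(1) show ?thesis by (intro that) auto
qed

section \<open>Semicontinuity of face numbers\<close>

text \<open>Away from the exposed face the functional attains a maximum, by compactness, and this
  is less than \<open>c\<close>.\<close>

lemma near_maximum_near_exposed_face:
  fixes P :: "'a::euclidean_space set"
  assumes "compact P" "P \<subseteq> {x. u \<bullet> x \<le> c}" and "\<eta> > 0"
  obtains \<gamma> where "\<gamma> > 0" "\<And>y. y \<in> P \<Longrightarrow> c - \<gamma> < u \<bullet> y \<Longrightarrow> \<exists>z\<in>P \<inter> {x. u \<bullet> x = c}. dist y z < \<eta>"
proof -
  define F where "F = P \<inter> {x. u \<bullet> x = c}"
  define K where "K = P - (\<Union>z\<in>F. ball z \<eta>)"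
  have K: "compact K"
    unfolding K_def by (intro compact_diff assms open_UN ballI open_ball)
  have less: "u \<bullet> y < c" if "y \<in> K" for y
  proof -
    have "y \<notin> F" using that assms(3) by (auto simp: K_def)
    then show ?thesis using that assms(2) by (force simp: K_def F_def)
  qed
  show ?thesis
  proof (cases "K = {}")
    case True
    show ?thesis
    proof (rule that[of 1])
      fix y assume "y \<in> P"
      with True obtain z where "z \<in> F" "y \<in> ball z \<eta>" by (auto simp: K_def)
      then show "\<exists>z\<in>P \<inter> {x. u \<bullet> x = c}. dist y z < \<eta>"
        by (auto simp: F_def dist_commute)
    qed simp
  next
    case False
    have "continuous_on K (\<lambda>y. u \<bullet> y)" by (intro continuous_intros)
    from continuous_attains_sup[OF K False this]
    obtain k where k: "k \<in> K" "\<And>y. y \<in> K \<Longrightarrow> u \<bullet> y \<le> u \<bullet> k" by blast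
    show ?thesis
    proof (rule that[of "c - u \<bullet> k"])
      show "0 < c - u \<bullet> k" using less[OF k(1)] by simp
      fix y assume y: "y \<in> P" "c - (c - u \<bullet> k) < u \<bullet> y"
      then have "y \<notin> K" using k(2)[of y] by auto
      with y(1) obtain z where "z \<in> F" "y \<in> ball z \<eta>" by (auto simp: K_def)
      then show "\<exists>z\<in>P \<inter> {x. u \<bullet> x = c}. dist y z < \<eta>"
        by (auto simp: F_def dist_commute)
    qed
  qed
qed

text \<open>For nonempty compact sets this says that their Hausdorff distance is less than \<open>\<epsilon>\<close>.\<close>

definition hausdorff_close :: "real \<Rightarrow> 'a::metric_space set \<Rightarrow> 'a set \<Rightarrow> bool" where
  "hausdorff_close \<epsilon> S T \<longleftrightarrow> (\<forall>x\<in>S. \<exists>y\<in>T. dist x y < \<epsilon>) \<and> (\<forall>y\<in>T. \<exists>x\<in>S. dist x y < \<epsilon>)"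

lemma hausdorff_close_mono: "hausdorff_close e S T \<Longrightarrow> e \<le> e' \<Longrightarrow> hausdorff_close e' S T"
  unfolding hausdorff_close_def by (meson order_less_le_trans)

lemma inner_le_of_dist_less:
  fixes u :: "'a::real_inner"
  assumes "dist x y < e"
  shows "u \<bullet> x \<le> u \<bullet> y + norm u * e"
proof -
  have "u \<bullet> (x - y) \<le> norm u * norm (x - y)" by (rule norm_cauchy_schwarz)
  also have "\<dots> \<le> norm u * e"
    using assms by (intro mult_left_mono) (auto simp: dist_norm)
  finally show ?thesis by (simp add: inner_diff_right)
qed

text \<open>Let \<open>u\<close> expose \<open>F\<close>, let \<open>L\<close> be the direction space of \<open>F\<close>, and let \<open>q\<close> be a
  generic point near \<open>p\<close>. On \<open>P \<inter> (p + L\<^sup>\<bottom>)\<close> the functional \<open>u\<close> is maximal at \<open>p\<close>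
  only, so one expects to find the required face of \<open>Q\<close> where \<open>u\<close> is maximal on \<open>Q \<inter> (q + L\<^sup>\<bottom>)\<close>. By duality this maximum is attained in a face \<open>G0\<close> of \<open>Q\<close> that is
  exposed by \<open>u + w\<close> for a small \<open>w \<in> L\<close>. Smallness of \<open>w\<close> keeps \<open>G0\<close> near \<open>F\<close>. A
  face of \<open>G0\<close> of dimension at most \<open>dim L\<close> still meets \<open>q + L\<^sup>\<bottom>\<close>, and genericity of \<open>q\<close>
  excludes smaller dimensions. A point of it over \<open>q\<close> is near \<open>F\<close> and projects near \<open>p\<close>,
  hence is near \<open>p\<close>.\<close>

lemma face_of_close_polytope:
  fixes P :: "'a::euclidean_space set"
  assumes P: "polytope P" and F: "F face_of P" and p: "p \<in> rel_interior F" and \<eta>: "\<eta> > 0"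
  shows "\<exists>\<epsilon>>0. \<forall>Q. polytope Q \<longrightarrow> hausdorff_close \<epsilon> P Q \<longrightarrow>
    (\<exists>G. G face_of Q \<and> aff_dim G = aff_dim F \<and>
      (\<forall>x\<in>G. \<exists>y\<in>F. dist x y < \<eta>) \<and> (\<exists>x\<in>G. dist x p < \<eta>))"
proof -
  let ?L = "direction F"
  have L: "subspace ?L" by (rule subspace_direction)
  obtain u c where u: "P \<subseteq> {x. u \<bullet> x \<le> c}" "F = P \<inter> {x. u \<bullet> x = c}"
    using F exposed_face_of_polyhedron[OF polytope_imp_polyhedron[OF P], of F]
    by (auto simp: exposed_face_of_def)
  obtain \<rho> where pF: "p \<in> F" and \<rho>: "\<rho> > 0" "cball p \<rho> \<inter> affine hull F \<subseteq> F"
    using p by (auto simp: mem_rel_interior_cball)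
  have F0: "F \<noteq> {}" and pP: "p \<in> P" and pc: "u \<bullet> p = c" using pF u by auto
  have dimF: "aff_dim F = int (dim ?L)" by (rule aff_dim_eq_dim_direction[OF F0])
  have in_F: "p + w \<in> F" if "w \<in> ?L" "norm w \<le> \<rho>" for w
    using that \<rho>(2) by (auto simp: affine_hull_eq_translate_direction[OF pF] dist_norm)
  \<comment> \<open>The points of the face found below will be within \<open>2 * \<theta>\<close> of \<open>F\<close>, and one of them
    within \<open>5 * \<theta>\<close> of \<open>p\<close>.\<close>
  define \<theta> where "\<theta> = \<eta> / 8"
  have \<theta>: "\<theta> > 0" using \<eta> by (simp add: \<theta>_def)
  obtain \<gamma> where \<gamma>: "\<gamma> > 0" "\<And>y. y \<in> P \<Longrightarrow> c - \<gamma> < u \<bullet> y \<Longrightarrow> \<exists>z\<in>F. dist y z < \<theta>"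
    using near_maximum_near_exposed_face[OF polytope_imp_compact[OF P] u(1) \<theta>] u(2) by metis
  define D where "D = diameter P + 1"
  have D: "D > 0" "\<And>x y. x \<in> P \<Longrightarrow> y \<in> P \<Longrightarrow> dist x y \<le> D"
    using diameter_ge_0[OF polytope_imp_bounded[OF P]]
      diameter_bounded_bound[OF polytope_imp_bounded[OF P]] by (auto simp: D_def intro: add_increasing2)
  \<comment> \<open>The bound on the multiplier \<open>w\<close>: as \<open>Q\<close> will have diameter at most \<open>D + 2\<close>, adding
    \<open>w\<close> to \<open>u\<close> changes differences of values on \<open>Q\<close> by at most a quarter of the gap \<open>\<gamma>\<close>.\<close>
  define \<delta> where "\<delta> = \<gamma> / (4 * (D + 2))"
  have \<delta>: "\<delta> > 0" "\<delta> * (D + 2) = \<gamma> / 4" using \<gamma>(1) D(1) by (auto simp: \<delta>_def field_simps)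
  \<comment> \<open>A bound for \<open>norm u\<close> that may be divided by: \<open>u\<close> can be 0 if \<open>F\<close> is all of \<open>P\<close>.\<close>
  define N where "N = norm u + 1"
  have N: "N > 0" "norm u \<le> N" by (auto simp: N_def add_nonneg_pos)
  define \<epsilon> where "\<epsilon> = Min {1, \<theta>, \<rho> / 8, \<gamma> / (8 * N), \<rho> * \<delta> / (8 * N)}"
  have \<epsilon>: "\<epsilon> > 0" "\<epsilon> \<le> 1" "\<epsilon> \<le> \<theta>" "\<epsilon> \<le> \<rho> / 8" "\<epsilon> \<le> \<gamma> / (8 * N)" "\<epsilon> \<le> \<rho> * \<delta> / (8 * N)"
    using \<theta> \<rho>(1) \<gamma>(1) \<delta>(1) N(1) by (auto simp: \<epsilon>_def)
  have u\<epsilon>: "norm u * \<epsilon> \<le> \<gamma> / 8" "norm u * \<epsilon> \<le> \<rho> * \<delta> / 8"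
  proof -
    have le: "norm u * \<epsilon> \<le> N * \<epsilon>" using N \<epsilon>(1) by (intro mult_right_mono) auto
    have "N * \<epsilon> \<le> \<gamma> / 8" using \<epsilon>(5) N(1) by (simp add: field_simps)
    with le show "norm u * \<epsilon> \<le> \<gamma> / 8" by simp
    have "N * \<epsilon> \<le> \<rho> * \<delta> / 8" using \<epsilon>(6) N(1) by (simp add: field_simps)
    with le show "norm u * \<epsilon> \<le> \<rho> * \<delta> / 8" by simp
  qed
  show ?thesis
  proof (intro exI[of _ \<epsilon>] conjI allI impI)
    show "\<epsilon> > 0" by (rule \<epsilon>)
    fix Q assume Q: "polytope Q" and close: "hausdorff_close \<epsilon> P Q"
    have PQ: "\<exists>y\<in>Q. dist x y < \<epsilon>" if "x \<in> P" for x
      using close that by (auto simp: hausdorff_close_def)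
    have QP: "\<exists>x\<in>P. dist x y < \<epsilon>" if "y \<in> Q" for y
      using close that by (auto simp: hausdorff_close_def)
    have Q0: "Q \<noteq> {}" using PQ[OF pP] by blast
    have Q_le: "u \<bullet> y \<le> c + norm u * \<epsilon>" if y: "y \<in> Q" for y
    proof -
      obtain x where x: "x \<in> P" "dist x y < \<epsilon>" using QP[OF y] by blast
      have "u \<bullet> y \<le> u \<bullet> x + norm u * \<epsilon>"
        using x(2) by (intro inner_le_of_dist_less) (simp add: dist_commute)
      then show ?thesis using x(1) u(1) by auto
    qed
    define \<H> where "\<H> = {H. H face_of Q \<and> aff_dim H < int (dim ?L)}"
    have \<H>: "finite \<H>" "\<And>H. H \<in> \<H> \<Longrightarrow> aff_dim H < int (dim ?L)"
      using finite_subset[OF _ finite_polytope_faces[OF Q], of \<H>] by (auto simp: \<H>_def)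
    have "0 < min \<theta> (\<rho> / 4)" using \<theta> \<rho>(1) by simp
    from exists_near_point_avoiding_low_dim[OF \<H>(1) L \<H>(2) this]
    obtain q where q: "dist p q < min \<theta> (\<rho> / 4)"
      and generic: "\<And>H x. H \<in> \<H> \<Longrightarrow> x \<in> H \<Longrightarrow> x - q \<notin> ?L\<^sup>\<bottom>"
      by metis
    \<comment> \<open>The point of \<open>F\<close> at distance \<open>\<rho>\<close> from \<open>p\<close> in the direction of \<open>w\<close> gains
      \<open>\<rho> * \<delta>\<close> from \<open>w\<close>, which outweighs the losses of order \<open>\<epsilon>\<close> and \<open>dist p q\<close>.\<close>
    have sphere: "\<exists>x\<in>Q. \<forall>y\<in>Q. u \<bullet> y < u \<bullet> x + w \<bullet> (x - q)" if w: "w \<in> ?L" "norm w = \<delta>" for w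
    proof -
      define f where "f = p + (\<rho> / \<delta>) *\<^sub>R w"
      have f: "f \<in> F"
        unfolding f_def using w \<rho>(1) \<delta>(1) by (intro in_F subspace_scale[OF L]) auto
      then have "f \<in> P" "u \<bullet> f = c" using u(2) by auto
      then obtain x where x: "x \<in> Q" "dist f x < \<epsilon>" using PQ by blast
      have 1: "c \<le> u \<bullet> x + norm u * \<epsilon>"
        using inner_le_of_dist_less[OF x(2), of u] \<open>u \<bullet> f = c\<close> by simp
      have "w \<bullet> (f - p) = \<rho> * \<delta>"
        using w(2) \<delta>(1) by (simp add: f_def power2_norm_eq_inner[symmetric] power2_eq_square)
      moreover have "w \<bullet> f \<le> w \<bullet> x + \<delta> * \<epsilon>"
        using inner_le_of_dist_less[OF x(2), of w] w(2) by simp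
      moreover have "w \<bullet> q \<le> w \<bullet> p + \<delta> * (\<rho> / 4)"
        using inner_le_of_dist_less[of q p "\<rho> / 4" w] w(2) q by (simp add: dist_commute)
      moreover have "\<delta> * \<epsilon> \<le> \<delta> * (\<rho> / 8)"
        using \<epsilon>(4) \<delta>(1) by (intro mult_left_mono) auto
      ultimately have 2: "w \<bullet> (x - q) \<ge> \<rho> * \<delta> - \<delta> * (\<rho> / 4) - \<delta> * (\<rho> / 8)"
        by (simp add: algebra_simps)
      have "u \<bullet> y < u \<bullet> x + w \<bullet> (x - q)" if "y \<in> Q" for y
      proof -
        have "\<rho> * \<delta> > 0" using \<rho> \<delta> by simp
        then show ?thesis using Q_le[OF that] 1 2 u\<epsilon>(2) by (simp add: algebra_simps)
      qed
      then show ?thesis using x(1) by blast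
    qed
    obtain w x where w: "w \<in> ?L" "norm w \<le> \<delta>" and x: "x \<in> Q" "x - q \<in> ?L\<^sup>\<bottom>"
      and opt: "\<And>y. y \<in> Q \<Longrightarrow> (u + w) \<bullet> y \<le> (u + w) \<bullet> x"
      using small_lagrange_multiplier[OF Q Q0 L \<delta>(1) sphere] by blast
    define G0 where "G0 = Q \<inter> {y. (u + w) \<bullet> y = (u + w) \<bullet> x}"
    have G0: "G0 face_of Q"
      unfolding G0_def using opt
      by (intro face_of_Int_supporting_hyperplane_le polytope_imp_convex Q)
    have G0_near: "\<exists>z\<in>F. dist y z < 2 * \<theta>" if y: "y \<in> G0" for y
    proof -
      obtain x1 where x1: "x1 \<in> Q" "dist p x1 < \<epsilon>" using PQ[OF pP] by blast
      have yQ: "y \<in> Q" using y by (simp add: G0_def)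
      then obtain y' where y': "y' \<in> P" "dist y' y < \<epsilon>" using QP by blast
      have "(u + w) \<bullet> x1 \<le> (u + w) \<bullet> y"
        using opt[OF x1(1)] y by (simp add: G0_def)
      moreover have "w \<bullet> (y - x1) \<le> \<delta> * (D + 2)"
      proof -
        have "dist y x1 \<le> dist y y' + dist y' p + dist p x1"
          using dist_triangle[of y x1 y'] dist_triangle[of y' x1 p] by simp
        also have "\<dots> \<le> D + 2"
          using y'(2) x1(2) D(2)[OF y'(1) pP] \<epsilon>(2) by (simp add: dist_commute)
        finally have "norm w * norm (y - x1) \<le> \<delta> * (D + 2)"
          using w(2) \<delta>(1) by (intro mult_mono) (auto simp: dist_norm)
        then show ?thesis using norm_cauchy_schwarz[of w "y - x1"] by simp
      qed
      moreover have "c \<le> u \<bullet> x1 + norm u * \<epsilon>"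
        using inner_le_of_dist_less[OF x1(2), of u] pc by simp
      moreover have "u \<bullet> y \<le> u \<bullet> y' + norm u * \<epsilon>"
        using y'(2) by (intro inner_le_of_dist_less) (simp add: dist_commute)
      ultimately have "c - \<gamma> < u \<bullet> y'"
        using \<delta>(2) u\<epsilon>(1) \<gamma>(1) by (simp add: inner_add_left inner_diff_right)
      then obtain z where "z \<in> F" "dist y' z < \<theta>" using \<gamma>(2)[OF y'(1)] by blast
      moreover have "dist y z \<le> dist y' y + dist y' z" by (rule dist_triangle3)
      ultimately show ?thesis using y'(2) \<epsilon>(3) by (intro bexI[of _ z]) auto
    qed
    have "x \<in> G0" using x(1) by (simp add: G0_def)
    then obtain H y where H: "H face_of G0" "y \<in> H" "y - q \<in> ?L\<^sup>\<bottom>" "aff_dim H \<le> int (dim ?L)"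
      using face_meeting_translate_dim_le[OF face_of_polytope_polytope[OF Q G0] L _ x(2)] by blast
    have HQ: "H face_of Q" using H(1) G0 by (rule face_of_trans)
    have "H \<notin> \<H>" using generic H(2,3) by blast
    then have dimH: "aff_dim H = aff_dim F" using H(4) HQ by (simp add: dimF \<H>_def)
    have H_near: "\<exists>z\<in>F. dist x z < 2 * \<theta>" if "x \<in> H" for x
      using G0_near face_of_imp_subset[OF H(1)] that by blast
    obtain z where z: "z \<in> F" "dist y z < 2 * \<theta>" using H_near[OF H(2)] by blast
    \<comment> \<open>The orthogonal projection to \<open>L\<close> is an isometry on \<open>F\<close> and agrees at \<open>y\<close> and \<open>q\<close>,
      so \<open>dist z p\<close> can be measured after projecting.\<close>
    have zp: "z - p \<in> ?L" using z(1) pF by (rule diff_mem_direction)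
    have "norm (z - p) * norm (z - p) = (z - p) \<bullet> (z - y) + (z - p) \<bullet> (y - q) + (z - p) \<bullet> (q - p)"
      by (simp add: power2_norm_eq_inner[symmetric] power2_eq_square[symmetric] inner_add_right[symmetric])
    also have "(z - p) \<bullet> (y - q) = 0"
      using zp H(3) by (simp add: orthogonal_comp_def orthogonal_def)
    also have "(z - p) \<bullet> (z - y) + 0 + (z - p) \<bullet> (q - p) \<le> norm (z - p) * norm (z - y) + norm (z - p) * norm (q - p)"
      using norm_cauchy_schwarz[of "z - p" "z - y"] norm_cauchy_schwarz[of "z - p" "q - p"] by simp
    also have "\<dots> = norm (z - p) * (dist y z + dist p q)"
      by (simp add: dist_norm norm_minus_commute algebra_simps)
    finally have "dist z p \<le> dist y z + dist p q"
      by (cases "z = p") (auto simp: dist_norm)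
    then have "dist y p < 5 * \<theta>"
      using dist_triangle[of y p z] z(2) q by simp
    then have y_near: "dist y p < \<eta>" using \<theta> by (simp add: \<theta>_def)
    have "\<exists>z\<in>F. dist x z < \<eta>" if "x \<in> H" for x
    proof -
      obtain z where "z \<in> F" "dist x z < 2 * \<theta>" using H_near[OF \<open>x \<in> H\<close>] by blast
      then show ?thesis using \<eta> by (intro bexI[of _ z]) (auto simp: \<theta>_def)
    qed
    then show "\<exists>G. G face_of Q \<and> aff_dim G = aff_dim F \<and>
      (\<forall>x\<in>G. \<exists>y\<in>F. dist x y < \<eta>) \<and> (\<exists>x\<in>G. dist x p < \<eta>)"
      using HQ dimH H(2) y_near by blast
  qed
qed

text \<open>Mark each nonempty face by a point of its relative interior. The marks of the other faces
  of the same dimension stay at a positive distance from a face, so the nearby face that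
  the preceding lemma assigns to it, lying near the face and passing near its mark,
  determines it.\<close>

lemma num_faces_lower_semicontinuous:
  fixes P :: "'a::euclidean_space set"
  assumes P: "polytope P"
  shows "\<exists>\<epsilon>>0. \<forall>Q. polytope Q \<longrightarrow> hausdorff_close \<epsilon> P Q \<longrightarrow> (\<forall>k. num_faces k P \<le> num_faces k Q)"
proof -
  define \<F> where "\<F> = {F. F face_of P \<and> F \<noteq> {}}"
  have fin: "finite \<F>"
    using finite_subset[OF _ finite_polytope_faces[OF P], of \<F>] by (auto simp: \<F>_def)
  have face: "F face_of P" "F \<noteq> {}" if "F \<in> \<F>" for F
    using that by (auto simp: \<F>_def)
  have "\<exists>p. p \<in> rel_interior F" if "F \<in> \<F>" for F
    using rel_interior_eq_empty[OF face_of_imp_convex[OF face(1)[OF that]]] face(2)[OF that] by blast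
  then obtain p where p: "\<And>F. F \<in> \<F> \<Longrightarrow> p F \<in> rel_interior F" by metis
  have apart: "\<exists>e>0. aff_dim F = aff_dim F' \<longrightarrow> F \<noteq> F' \<longrightarrow> (\<forall>z\<in>F. 2 * e \<le> dist (p F') z)"
    if F: "F \<in> \<F>" and F': "F' \<in> \<F>" for F F'
  proof (cases "aff_dim F = aff_dim F' \<and> F \<noteq> F'")
    case True
    have "p F' \<notin> F"
    proof
      assume "p F' \<in> F"
      then have sub: "F' \<subseteq> F"
        using subset_of_face_of[OF face(1)[OF F] face_of_imp_subset[OF face(1)[OF F']]] p[OF F'] by blast
      have "F' face_of F"
        by (rule face_of_subset[OF face(1)[OF F'] sub face_of_imp_subset[OF face(1)[OF F]]])
      then show False
        using face_of_aff_dim_lt[of F F'] face_of_imp_convex[OF face(1)[OF F]] True by auto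
    qed
    moreover have "closed F"
      using face_of_polytope_polytope[OF P face(1)[OF F]] by (rule polytope_imp_closed)
    ultimately obtain d where "d > 0" "\<forall>z\<in>F. d \<le> dist (p F') z"
      using separate_point_closed by blast
    then show ?thesis by (intro exI[of _ "d / 2"]) auto
  next
    case False
    then show ?thesis by (intro exI[of _ 1]) auto
  qed
  have "\<exists>\<eta>>0. \<forall>(F, F')\<in>\<F> \<times> \<F>. aff_dim F = aff_dim F' \<longrightarrow> F \<noteq> F' \<longrightarrow> (\<forall>z\<in>F. 2 * \<eta> \<le> dist (p F') z)"
  proof (rule finite_common_radius)
    fix s :: "'a set \<times> 'a set" and e e' :: real
    assume "case s of (F, F') \<Rightarrow> aff_dim F = aff_dim F' \<longrightarrow> F \<noteq> F' \<longrightarrow> (\<forall>z\<in>F. 2 * e \<le> dist (p F') z)"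
      and "e' \<le> e"
    moreover from this(2) have "2 * e' \<le> 2 * e" by simp
    ultimately show "case s of (F, F') \<Rightarrow> aff_dim F = aff_dim F' \<longrightarrow> F \<noteq> F' \<longrightarrow> (\<forall>z\<in>F. 2 * e' \<le> dist (p F') z)"
      unfolding case_prod_beta by (meson order_trans)
  qed (use fin apart in auto)
  then obtain \<eta> where \<eta>: "\<eta> > 0"
    and sep: "\<And>F F' z. F \<in> \<F> \<Longrightarrow> F' \<in> \<F> \<Longrightarrow> aff_dim F = aff_dim F' \<Longrightarrow> F \<noteq> F' \<Longrightarrow> z \<in> F \<Longrightarrow> 2 * \<eta> \<le> dist (p F') z"
    by blast
  define good where "good F Q G \<longleftrightarrow> G face_of Q \<and> aff_dim G = aff_dim F \<and>
      (\<forall>x\<in>G. \<exists>y\<in>F. dist x y < \<eta>) \<and> (\<exists>x\<in>G. dist x (p F) < \<eta>)" for F Q G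
  have "\<exists>\<epsilon>>0. \<forall>F\<in>\<F>. \<forall>Q. polytope Q \<longrightarrow> hausdorff_close \<epsilon> P Q \<longrightarrow> (\<exists>G. good F Q G)"
  proof (rule finite_common_radius[OF fin])
    show "\<exists>e>0. \<forall>Q. polytope Q \<longrightarrow> hausdorff_close e P Q \<longrightarrow> (\<exists>G. good F Q G)" if "F \<in> \<F>" for F
      unfolding good_def by (rule face_of_close_polytope[OF P face(1)[OF that] p[OF that] \<eta>])
  qed (meson hausdorff_close_mono)
  then obtain \<epsilon> where \<epsilon>: "\<epsilon> > 0"
    and ex: "\<And>F Q. F \<in> \<F> \<Longrightarrow> polytope Q \<Longrightarrow> hausdorff_close \<epsilon> P Q \<Longrightarrow> \<exists>G. good F Q G"
    by blast
  have "num_faces k P \<le> num_faces k Q" if Q: "polytope Q" "hausdorff_close \<epsilon> P Q" for Q k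
  proof (cases "k < 0")
    case True
    have "F = {} \<longleftrightarrow> F face_of S" if "aff_dim F = k" for F S :: "'a set"
      using that True by (metis aff_dim_negative_iff empty_face_of)
    then have "{F. F face_of S \<and> aff_dim F = k} = {F. F = {} \<and> aff_dim F = k}" for S :: "'a set"
      by blast
    then show ?thesis by (simp add: num_faces_def)
  next
    case False
    obtain G where G: "\<And>F. F \<in> \<F> \<Longrightarrow> good F Q (G F)"
      using ex[OF _ Q] by metis
    let ?S = "\<lambda>P. {F. F face_of P \<and> aff_dim F = k}"
    have S: "F \<in> \<F>" "aff_dim F = k" if "F \<in> ?S P" for F
      using that False by (auto simp: \<F>_def)
    have "inj_on G (?S P)"
    proof (rule inj_onI, rule ccontr)
      fix F F' assume F: "F \<in> ?S P" and F': "F' \<in> ?S P" and eq: "G F = G F'" and ne: "F \<noteq> F'"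
      obtain x where x: "x \<in> G F'" "dist x (p F') < \<eta>"
        using G[OF S(1)[OF F']] by (auto simp: good_def)
      then obtain z where z: "z \<in> F" "dist x z < \<eta>"
        using G[OF S(1)[OF F]] eq by (force simp: good_def)
      have "2 * \<eta> \<le> dist (p F') z"
        using S[OF F] S[OF F'] ne z(1) by (intro sep) auto
      with x(2) z(2) dist_triangle3[of "p F'" z x] show False by simp
    qed
    moreover have "G ` ?S P \<subseteq> ?S Q"
    proof (rule image_subsetI)
      fix F assume F: "F \<in> ?S P"
      show "G F \<in> ?S Q"
        using G[OF S(1)[OF F]] S(2)[OF F] by (simp add: good_def)
    qed
    moreover have "finite (?S Q)"
      by (rule finite_subset[OF _ finite_polytope_faces[OF Q(1)]]) auto
    ultimately show ?thesis
      unfolding num_faces_def by (rule card_inj_on_le)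
  qed
  with \<epsilon> show ?thesis by blast
qed

section \<open>Minkowski sums\<close>

lemma polytope_set_sum:
  fixes S :: "'i \<Rightarrow> 'a::euclidean_space set"
  assumes "finite I" "\<And>i. i \<in> I \<Longrightarrow> polytope (S i)"
  shows "polytope (\<Sum>i\<in>I. S i)"
proof -
  obtain V where V: "\<And>i. i \<in> I \<Longrightarrow> finite (V i) \<and> S i = convex hull V i"
    using assms(2) unfolding polytope_def by metis
  then have "(\<Sum>i\<in>I. S i) = convex hull (\<Sum>i\<in>I. V i)"
    by (simp add: convex_hull_set_sum)
  moreover have "finite (\<Sum>i\<in>I. V i)"
    using V by (intro finite_set_sum assms(1)) auto
  ultimately show ?thesis by (metis polytope_convex_hull)
qed

text \<open>A functional exposing a face of the sum exposes a face of each summand, and a sum of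
  points is maximal for it exactly if every summand is.\<close>

lemma face_of_set_sum_decomposes:
  fixes S :: "'i \<Rightarrow> 'a::euclidean_space set"
  assumes I: "finite I" and S: "\<And>i. i \<in> I \<Longrightarrow> polytope (S i)" "\<And>i. i \<in> I \<Longrightarrow> S i \<noteq> {}"
    and F: "F face_of (\<Sum>i\<in>I. S i)" "F \<noteq> {}"
  obtains G where "\<And>i. i \<in> I \<Longrightarrow> G i face_of S i" "\<And>i. i \<in> I \<Longrightarrow> G i \<noteq> {}" "F = (\<Sum>i\<in>I. G i)"
proof -
  let ?P = "\<Sum>i\<in>I. S i"
  have "polytope ?P" using I S(1) by (rule polytope_set_sum)
  then obtain a b where ab: "?P \<subseteq> {x. a \<bullet> x \<le> b}" "F = ?P \<inter> {x. a \<bullet> x = b}"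
    using F(1) exposed_face_of_polyhedron[OF polytope_imp_polyhedron, of ?P F]
    by (auto simp: exposed_face_of_def)
  have "\<exists>s\<in>S i. \<forall>y\<in>S i. a \<bullet> y \<le> a \<bullet> s" if "i \<in> I" for i
    using that S by (intro continuous_attains_sup polytope_imp_compact continuous_intros)
  then obtain s where s: "\<And>i. i \<in> I \<Longrightarrow> s i \<in> S i" "\<And>i y. i \<in> I \<Longrightarrow> y \<in> S i \<Longrightarrow> a \<bullet> y \<le> a \<bullet> s i"
    by metis
  have mem: "sum x I \<in> ?P" if "\<And>i. i \<in> I \<Longrightarrow> x i \<in> S i" for x
    using that by (auto simp: set_sum_alt[OF I])
  have "a \<bullet> sum s I \<le> b"
    using mem[OF s(1)] ab(1) by auto
  moreover obtain x where x: "\<And>i. i \<in> I \<Longrightarrow> x i \<in> S i" "a \<bullet> sum x I = b"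
    using F(2) ab(2) by (auto simp: set_sum_alt[OF I])
  moreover have "(\<Sum>i\<in>I. a \<bullet> x i) \<le> (\<Sum>i\<in>I. a \<bullet> s i)"
    using x(1) s(2) by (intro sum_mono) auto
  ultimately have b: "b = (\<Sum>i\<in>I. a \<bullet> s i)"
    by (simp add: inner_sum_right)
  define G where "G i = S i \<inter> {y. a \<bullet> y = a \<bullet> s i}" for i
  have "F = (\<Sum>i\<in>I. G i)"
  proof
    show "F \<subseteq> (\<Sum>i\<in>I. G i)"
    proof
      fix z assume "z \<in> F"
      then obtain x where x: "\<And>i. i \<in> I \<Longrightarrow> x i \<in> S i" "z = sum x I" "a \<bullet> z = b"
        using ab(2) by (auto simp: set_sum_alt[OF I])
      have "a \<bullet> x i = a \<bullet> s i" if "i \<in> I" for i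
        using sum_mono_inv[of "\<lambda>i. a \<bullet> x i" I "\<lambda>i. a \<bullet> s i"] x s(2) b I that
        by (auto simp: inner_sum_right)
      then show "z \<in> (\<Sum>i\<in>I. G i)"
        using x by (auto simp: set_sum_alt[OF I] G_def)
    qed
    show "(\<Sum>i\<in>I. G i) \<subseteq> F"
    proof
      fix z assume "z \<in> (\<Sum>i\<in>I. G i)"
      then obtain x where x: "\<And>i. i \<in> I \<Longrightarrow> x i \<in> S i" "\<And>i. i \<in> I \<Longrightarrow> a \<bullet> x i = a \<bullet> s i" "z = sum x I"
        by (auto simp: set_sum_alt[OF I] G_def)
      then show "z \<in> F"
        using mem[OF x(1)] by (simp add: ab(2) b inner_sum_right)
    qed
  qed
  moreover have "G i face_of S i" if "i \<in> I" for i
    unfolding G_def using that S(1) s(2)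
    by (intro face_of_Int_supporting_hyperplane_le polytope_imp_convex)
  moreover have "G i \<noteq> {}" if "i \<in> I" for i
    using s(1)[OF that] by (auto simp: G_def)
  ultimately show ?thesis by (rule that[rotated -1])
qed

lemma num_faces_injective_linear_image:
  fixes f :: "'a::euclidean_space \<Rightarrow> 'b::euclidean_space"
  assumes "linear f" "inj f"
  shows "num_faces k (f ` S) = num_faces k S"
proof -
  have "{F. F face_of f ` S \<and> aff_dim F = k} = (image f) ` {F. F face_of S \<and> aff_dim F = k}"
  proof -
    have "F face_of f ` S \<longleftrightarrow> (\<exists>T. T face_of S \<and> F = f ` T)" for F
      using faces_of_linear_image[OF assms, of S] by blast
    then show ?thesis by (auto simp: aff_dim_injective_linear_image[OF assms])
  qed
  moreover have "inj_on (image f) A" for A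
    using assms(2) by (simp add: inj_on_def inj_image_eq_iff)
  ultimately show ?thesis
    by (simp add: num_faces_def card_image)
qed

lemma hausdorff_close_set_sum_images:
  fixes S :: "'i \<Rightarrow> 'a::real_normed_vector set"
  assumes I: "finite I"
    and R: "\<And>i x. i \<in> I \<Longrightarrow> x \<in> S i \<Longrightarrow> norm x \<le> R"
    and A: "\<And>i x. i \<in> I \<Longrightarrow> norm (A i x - x) \<le> \<delta> * norm x"
    and \<delta>: "0 \<le> \<delta>" "real (card I) * (\<delta> * R) < \<epsilon>"
  shows "hausdorff_close \<epsilon> (\<Sum>i\<in>I. S i) (\<Sum>i\<in>I. A i ` S i)"
proof -
  have close: "dist (\<Sum>i\<in>I. x i) (\<Sum>i\<in>I. A i (x i)) < \<epsilon>" if x: "\<And>i. i \<in> I \<Longrightarrow> x i \<in> S i" for x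
  proof -
    have "norm (A i (x i) - x i) \<le> \<delta> * R" if "i \<in> I" for i
      using A[OF that, of "x i"] mult_left_mono[OF R[OF that x[OF that]] \<delta>(1)] by linarith
    then have "norm (\<Sum>i\<in>I. A i (x i) - x i) \<le> real (card I) * (\<delta> * R)"
      using sum_norm_le[of I "\<lambda>i. A i (x i) - x i" "\<lambda>i. \<delta> * R"] by simp
    then show ?thesis
      using \<delta>(2) by (simp add: dist_norm norm_minus_commute sum_subtractf)
  qed
  show ?thesis
    unfolding hausdorff_close_def
  proof (intro conjI ballI)
    fix y assume "y \<in> (\<Sum>i\<in>I. S i)"
    then obtain x where x: "\<And>i. i \<in> I \<Longrightarrow> x i \<in> S i" "y = (\<Sum>i\<in>I. x i)"
      by (auto simp: set_sum_alt[OF I])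
    have "(\<Sum>i\<in>I. A i (x i)) \<in> (\<Sum>i\<in>I. A i ` S i)"
      using x(1) by (force simp: set_sum_alt[OF I])
    then show "\<exists>z\<in>(\<Sum>i\<in>I. A i ` S i). dist y z < \<epsilon>"
      using close[OF x(1)] x(2) by blast
  next
    fix z assume "z \<in> (\<Sum>i\<in>I. A i ` S i)"
    then obtain s where s: "\<And>i. i \<in> I \<Longrightarrow> s i \<in> A i ` S i" "z = sum s I"
      by (auto simp: set_sum_alt[OF I])
    then obtain x where x: "\<And>i. i \<in> I \<Longrightarrow> x i \<in> S i \<and> s i = A i (x i)"
      unfolding image_iff by metis
    have "(\<Sum>i\<in>I. x i) \<in> (\<Sum>i\<in>I. S i)"
      using x by (auto simp: set_sum_alt[OF I])
    moreover have "z = (\<Sum>i\<in>I. A i (x i))" using s(2) x by simp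
    ultimately show "\<exists>y\<in>(\<Sum>i\<in>I. S i). dist y z < \<epsilon>"
      using close[of x] x by blast
  qed
qed

section \<open>Linear images of the summands in general position\<close>

text \<open>Under linear maps in general position with respect to the direction spaces of all
  faces, the dimension of a sum of faces is the sum of the dimensions unless that exceeds the
  dimension of the space. A facet does not have full dimension, so the second case is excluded.\<close>

lemma general_position_images:
  fixes P :: "nat \<Rightarrow> 'a::euclidean_space set" and A :: "nat \<Rightarrow> 'a \<Rightarrow> 'a"
  assumes P: "\<And>i. i \<in> {1..r} \<Longrightarrow> polytope (P i)" "\<And>i. i \<in> {1..r} \<Longrightarrow> P i \<noteq> {}"
    and A: "\<And>i. i \<in> {1..r} \<Longrightarrow> linear (A i)" "\<And>i. i \<in> {1..r} \<Longrightarrow> inj (A i)"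
    and generic: "\<And>H. (\<And>i. i \<in> {1..r} \<Longrightarrow> H i face_of P i) \<Longrightarrow>
      min DIM('a) (\<Sum>i\<in>{1..r}. dim (direction (H i))) \<le> dim (\<Sum>i\<in>{1..r}. A i ` direction (H i))"
  shows "relatively_in_general_position r (\<lambda>i. A i ` P i)"
  unfolding relatively_in_general_position_def
proof (intro allI impI)
  let ?I = "{1..r}"
  fix F assume facet: "F facet_of (\<Sum>i\<in>?I. A i ` P i)"
  then have F: "F face_of (\<Sum>i\<in>?I. A i ` P i)" "F \<noteq> {}" "aff_dim F = aff_dim (\<Sum>i\<in>?I. A i ` P i) - 1"
    by (auto simp: facet_of_def)
  have poly: "polytope (A i ` P i)" "A i ` P i \<noteq> {}" if "i \<in> ?I" for i
    using that P A by (simp_all add: polytope_linear_image)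
  obtain G where G: "\<And>i. i \<in> ?I \<Longrightarrow> G i face_of A i ` P i" "\<And>i. i \<in> ?I \<Longrightarrow> G i \<noteq> {}" "F = (\<Sum>i\<in>?I. G i)"
    using face_of_set_sum_decomposes[of ?I "\<lambda>i. A i ` P i" F, OF finite_atLeastAtMost poly F(1,2)]
    by blast
  have "\<exists>H. H face_of P i \<and> G i = A i ` H" if "i \<in> ?I" for i
    using faces_of_linear_image[OF A(1)[OF that] A(2)[OF that], of "P i"] G(1)[OF that] by blast
  then obtain H where H: "\<And>i. i \<in> ?I \<Longrightarrow> H i face_of P i" "\<And>i. i \<in> ?I \<Longrightarrow> G i = A i ` H i"
    by metis
  have dirG: "direction (G i) = A i ` direction (H i)" if "i \<in> ?I" for i
    using H(2)[OF that] direction_linear_image[OF A(1)[OF that]] by simp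
  have dim_eq: "dim (direction (G i)) = dim (direction (H i))" if "i \<in> ?I" for i
    unfolding dirG[OF that] using A[OF that] by (intro dim_image_eq) (auto intro: inj_on_subset)
  have "direction F = (\<Sum>i\<in>?I. direction (G i))"
    unfolding G(3) using G(2) by (intro direction_set_sum) auto
  moreover have "aff_dim F < DIM('a)"
    using F(3) aff_dim_le_DIM[of "\<Sum>i\<in>?I. A i ` P i"] by simp
  then have "dim (direction F) < DIM('a)"
    by (simp add: aff_dim_eq_dim_direction[OF F(2)])
  ultimately have small: "dim (\<Sum>i\<in>?I. direction (G i)) < DIM('a)" by simp
  have "min DIM('a) (\<Sum>i\<in>?I. dim (direction (G i))) \<le> dim (\<Sum>i\<in>?I. direction (G i))"
    using generic[of H] H(1) dirG dim_eq by simp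
  moreover have "dim (\<Sum>i\<in>?I. direction (G i)) \<le> (\<Sum>i\<in>?I. dim (direction (G i)))"
    by (rule dim_set_sum_le) (simp_all add: subspace_direction)
  ultimately have "dim (direction F) = (\<Sum>i\<in>?I. dim (direction (G i)))"
    using small \<open>direction F = _\<close> by simp
  then have "aff_dim F = (\<Sum>i\<in>?I. aff_dim (G i))"
    using G(2) by (simp add: aff_dim_eq_dim_direction F(2))
  then have "exact_decomposition r (\<lambda>i. A i ` P i) F G"
    using G by (simp add: exact_decomposition_def face_decomposition_def)
  then show "\<exists>G. exact_decomposition r (\<lambda>i. A i ` P i) F G" by blast
qed

theorem theorem1:
  fixes P :: "nat \<Rightarrow> (real ^ 'n) set" and r :: nat
  assumes "r \<ge> 1"
    and "\<And>i. i \<in> {1..r} \<Longrightarrow> polytope (P i) \<and> P i \<noteq> {}"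
  shows "\<exists>P' :: nat \<Rightarrow> (real ^ 'n) set.
    (\<forall>i\<in>{1..r}. polytope (P' i) \<and> P' i \<noteq> {}) \<and>
    relatively_in_general_position r P' \<and>
    (\<forall>i\<in>{1..r}. \<forall>k. num_faces k (P' i) = num_faces k (P i)) \<and>
    (\<forall>k. num_faces k (\<Sum>i\<in>{1..r}. P' i) \<ge> num_faces k (\<Sum>i\<in>{1..r}. P i))"
proof -
  let ?I = "{1..r}"
  have P: "polytope (P i)" "P i \<noteq> {}" if "i \<in> ?I" for i
    using assms(2)[OF that] by auto
  have "polytope (\<Sum>i\<in>?I. P i)"
    using P(1) by (intro polytope_set_sum) auto
  then obtain \<epsilon> where \<epsilon>: "\<epsilon> > 0"
    and semicont: "\<And>Q k. polytope Q \<Longrightarrow> hausdorff_close \<epsilon> (\<Sum>i\<in>?I. P i) Q \<Longrightarrow>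
      num_faces k (\<Sum>i\<in>?I. P i) \<le> num_faces k Q"
    using num_faces_lower_semicontinuous by meson
  have "bounded (\<Union>i\<in>?I. P i)"
    using P(1) by (intro bounded_UN) (auto intro: polytope_imp_bounded)
  then obtain R where R: "R > 0" "\<And>i x. i \<in> ?I \<Longrightarrow> x \<in> P i \<Longrightarrow> norm x \<le> R"
    unfolding bounded_pos by blast
  define \<delta> where "\<delta> = min 1 (\<epsilon> / (2 * (real r * R)))"
  have rR: "real r * R > 0" using assms(1) R(1) by simp
  then have \<delta>: "0 < \<delta>" "\<delta> \<le> 1" using \<epsilon> by (auto simp: \<delta>_def)
  have "\<delta> * (real r * R) \<le> \<epsilon> / (2 * (real r * R)) * (real r * R)"
    using rR by (intro mult_right_mono) (auto simp: \<delta>_def)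
  also have "\<dots> < \<epsilon>" using rR \<epsilon> by simp
  finally have \<delta>R: "real (card ?I) * (\<delta> * R) < \<epsilon>" by (simp add: algebra_simps)
  define \<L> where "\<L> = (\<lambda>H i. direction (H i)) ` (PiE ?I (\<lambda>i. {F. F face_of P i}))"
  have "finite \<L>"
    unfolding \<L>_def using P(1) by (intro finite_imageI finite_PiE finite_polytope_faces) auto
  moreover have "subspace (L i)" if "L \<in> \<L>" for L i
    using that by (auto simp: \<L>_def subspace_direction)
  ultimately obtain A where A: "\<And>i. i \<in> ?I \<Longrightarrow> linear (A i)" "\<And>i. i \<in> ?I \<Longrightarrow> inj (A i)"
    and close: "\<And>i x. i \<in> ?I \<Longrightarrow> norm (A i x - x) \<le> \<delta> * norm x"
    and generic: "\<And>L. L \<in> \<L> \<Longrightarrow> min DIM(real ^ 'n) (\<Sum>i\<in>?I. dim (L i)) \<le> dim (\<Sum>i\<in>?I. A i ` L i)"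
    using linear_maps_in_general_position[OF finite_atLeastAtMost[of 1 r] _ _ \<delta>, of \<L>] by blast
  have polyA: "polytope (A i ` P i)" if "i \<in> ?I" for i
    using that P A by (intro polytope_linear_image)
  have "relatively_in_general_position r (\<lambda>i. A i ` P i)"
  proof (rule general_position_images)
    fix H assume H: "\<And>i. i \<in> ?I \<Longrightarrow> H i face_of P i"
    \<comment> \<open>Restricting to the indices makes the family a member of the finite \<open>\<L>\<close>.\<close>
    let ?L = "\<lambda>i. direction (restrict H ?I i)"
    have "?L \<in> \<L>"
      unfolding \<L>_def using H by (intro imageI) auto
    from generic[OF this]
    show "min DIM(real ^ 'n) (\<Sum>i\<in>?I. dim (direction (H i))) \<le> dim (\<Sum>i\<in>?I. A i ` direction (H i))"
      by simp
  qed (use P A in auto)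
  moreover have "num_faces k (\<Sum>i\<in>?I. P i) \<le> num_faces k (\<Sum>i\<in>?I. A i ` P i)" for k
  proof (rule semicont)
    show "polytope (\<Sum>i\<in>?I. A i ` P i)"
      using polyA by (intro polytope_set_sum) auto
    show "hausdorff_close \<epsilon> (\<Sum>i\<in>?I. P i) (\<Sum>i\<in>?I. A i ` P i)"
      using R(2) close \<delta>(1) \<delta>R by (intro hausdorff_close_set_sum_images[where R = R and \<delta> = \<delta>]) auto
  qed
  moreover have "num_faces k (A i ` P i) = num_faces k (P i)" if "i \<in> ?I" for i k
    using A[OF that] by (rule num_faces_injective_linear_image)
  ultimately show ?thesis
    using P polyA
    by (intro exI[of _ "\<lambda>i. A i ` P i"]) auto
qed

end
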